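(* Let $N\ge1$ and let $\Sigma, C\in\mathbb R^{N\times N}$ be simultaneously orthogonally diagonalizable: there is an orthogonal matrix $U$ with $$\Sigma=U\Lambda_\Sigma U^{\mathsf T},\qquad C=U\Lambda_C U^{\mathsf T},$$ where $\Lambda_\Sigma=\operatorname{diag}(\sigma_1^2,\dots,\sigma_N^2)$ and $\Lambda_C=\operatorname{diag}(c_1,\dots,c_N)$ with $\sigma_i^2>0$ and $c_i>0$ for all $i$. Fix $\lambda\in[0,1]$ and let $M_\lambda:=\lambda\Sigma+(1-\lambda)C$. Then the problem $$\min_{w\in\mathbb R^N} w^{\mathsf T}M_\lambda w\quad\text{s.t.}\quad \mathbf 1^{\mathsf T}w=1$$ (with no sign constraint on the entries of $w$) has the unique optimal solution $$w^{\ast}(\lambda)=\frac{M_\lambda^{-1}\mathbf 1}{\mathbf 1^{\mathsf T}M_\lambda^{-1}\mathbf 1}.$$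
   Context: $\mathbf 1\in\mathbb R^N$ is the all-ones vector. *)

theory Defs
  imports "HOL-Analysis.Analysis"
begin

definition diag_matrix :: "real ^ 'n \<Rightarrow> real ^ 'n ^ 'n" where
  "diag_matrix d = (\<chi> i j. if i = j then d $ i else 0)"

definition mixed_matrix :: "real \<Rightarrow> real ^ 'n ^ 'n \<Rightarrow> real ^ 'n ^ 'n \<Rightarrow> real ^ 'n ^ 'n" where
  "mixed_matrix t S C = t *\<^sub>R S + (1 - t) *\<^sub>R C"

text \<open>In \<^typ>\<open>real ^ 'n\<close> the constant \<^term>\<open>1 :: real ^ 'n\<close> is the all-ones vector.\<close>

definition budget_weight :: "real ^ 'n ^ 'n \<Rightarrow> real ^ 'n" where
  "budget_weight M = (1 / (1 \<bullet> (matrix_inv M *v 1))) *\<^sub>R (matrix_inv M *v 1)"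

end

theory Submission
  imports Defs
begin

text \<open>
  The matrix \<open>M\<close> is symmetric positive definite, so \<open>M w\<close> is a multiple of the all-ones
  vector at \<open>w = budget_weight M\<close>. Hence \<open>M w\<close> is orthogonal to \<open>v - w\<close> for every
  feasible \<open>v\<close>, and \<open>v\<^sup>T M v = w\<^sup>T M w + (v - w)\<^sup>T M (v - w)\<close>.
\<close>

text \<open>Symmetry is required explicitly: over the reals it does not follow from positivity of
  the quadratic form.\<close>

definition pos_def_matrix :: "real ^ 'n ^ 'n \<Rightarrow> bool" where
  "pos_def_matrix M \<longleftrightarrow> transpose M = M \<and> (\<forall>x. x \<noteq> 0 \<longrightarrow> 0 < x \<bullet> (M *v x))"

text \<open>A kernel vector makes the quadratic form vanish, so the kernel is trivial, which
  suffices for a square matrix.\<close>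

lemma pos_def_matrix_invertible:
  assumes "pos_def_matrix M"
  shows "invertible M"
proof -
  have "x = 0" if "M *v x = 0" for x
    using assms that unfolding pos_def_matrix_def by (metis inner_zero_right less_irrefl)
  then show ?thesis
    by (simp add: invertible_left_inverse matrix_left_invertible_ker)
qed

lemma invertible_matrix_inv_mult_vector:
  assumes "invertible M"
  shows "M *v (matrix_inv M *v x) = x"
proof -
  have "M ** matrix_inv M = mat 1"
    using someI_ex[OF assms[unfolded invertible_def]] by (simp add: matrix_inv_def)
  then show ?thesis
    by (simp add: matrix_vector_mul_assoc)
qed

lemma diag_matrix_mult_vector: "diag_matrix d *v x = (\<chi> i. d $ i * x $ i)"
proof -
  have "(\<Sum>j\<in>UNIV. (if i = j then d $ i else 0) * x $ j) = d $ i * x $ i" for i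
    by (subst sum.cong[where h = "\<lambda>j. if i = j then d $ i * x $ j else 0"]) auto
  then show ?thesis
    by (simp add: diag_matrix_def matrix_vector_mult_def vec_eq_iff)
qed

lemma transpose_diag_matrix: "transpose (diag_matrix d) = diag_matrix d"
  by (auto simp: diag_matrix_def transpose_def vec_eq_iff)

text \<open>In the eigenbasis coordinates \<open>y = transpose U *v x\<close> the form is a weighted
  sum of squares with positive weights.\<close>

lemma pos_def_matrix_diagonalizable:
  assumes U: "orthogonal_matrix U" and pos: "\<And>i. 0 < d $ i"
  shows "pos_def_matrix (U ** diag_matrix d ** transpose U)"
  unfolding pos_def_matrix_def
proof (intro conjI allI impI)
  show "transpose (U ** diag_matrix d ** transpose U) = U ** diag_matrix d ** transpose U"
    by (simp add: matrix_transpose_mul transpose_diag_matrix matrix_mul_assoc)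
next
  fix x :: "real ^ 'a"
  assume "x \<noteq> 0"
  define y where "y = transpose U *v x"
  \<comment> \<open>The deleted simp rule would turn \<open>transpose U *v x\<close> into
    \<open>x v* U\<close> and block reassociation.\<close>
  have "U *v y = x"
    using U by (simp add: y_def orthogonal_matrix_def matrix_vector_mul_assoc
        del: transpose_matrix_vector)
  with \<open>x \<noteq> 0\<close> obtain k where "y $ k \<noteq> 0"
    by (metis matrix_vector_mult_0_right vec_eq_iff zero_index)
  have "x \<bullet> ((U ** diag_matrix d ** transpose U) *v x) = x \<bullet> (U *v (diag_matrix d *v y))"
    by (simp add: y_def matrix_vector_mul_assoc matrix_mul_assoc
        del: transpose_matrix_vector)
  also have "\<dots> = y \<bullet> (diag_matrix d *v y)"
    by (simp add: y_def dot_lmul_matrix)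
  also have "\<dots> = (\<Sum>i\<in>UNIV. d $ i * (y $ i)\<^sup>2)"
    by (simp add: diag_matrix_mult_vector inner_vec_def power2_eq_square mult_ac)
  also have "\<dots> > 0"
    using pos \<open>y $ k \<noteq> 0\<close> by (intro sum_pos2[of _ k]) (auto simp: less_imp_le)
  finally show "0 < x \<bullet> ((U ** diag_matrix d ** transpose U) *v x)" .
qed

lemma matrix_add_rdistrib:
  fixes A B :: "'a::semiring_1 ^ 'n ^ 'm"
  shows "(A + B) ** C = A ** C + B ** C"
  by (simp add: matrix_matrix_mult_def vec_eq_iff sum.distrib distrib_right)

text \<open>This is where the common eigenbasis enters: mixing the matrices only mixes their
  eigenvalues.\<close>

lemma mixed_matrix_diagonal:
  fixes U V :: "real ^ 'n ^ 'n"
  shows "mixed_matrix t (U ** diag_matrix a ** V) (U ** diag_matrix b ** V)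
    = U ** diag_matrix (t *\<^sub>R a + (1 - t) *\<^sub>R b) ** V"
proof -
  have "diag_matrix (t *\<^sub>R a + (1 - t) *\<^sub>R b)
      = t *\<^sub>R diag_matrix a + (1 - t) *\<^sub>R diag_matrix b"
    by (simp add: diag_matrix_def vec_eq_iff)
  then show ?thesis
    by (simp add: mixed_matrix_def matrix_add_ldistrib matrix_add_rdistrib
        scalar_matrix_assoc matrix_scalar_ac)
qed

text \<open>Write \<open>v = w + (v - w)\<close>; symmetry of \<open>M\<close> merges the two cross
  terms.\<close>

lemma pos_def_matrix_quadratic_expand:
  assumes "pos_def_matrix M"
  shows "v \<bullet> (M *v v) = w \<bullet> (M *v w) + 2 * ((v - w) \<bullet> (M *v w)) + (v - w) \<bullet> (M *v (v - w))"
proof -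
  have "v \<bullet> (M *v w) = w \<bullet> (M *v v)"
    using assms unfolding pos_def_matrix_def
    by (metis dot_lmul_matrix inner_commute vector_transpose_matrix)
  then show ?thesis
    by (simp add: matrix_vector_mult_diff_distrib inner_diff_left inner_diff_right)
qed

text \<open>If \<open>M *v x = 1\<close>, then \<open>1 \<bullet> x\<close> is the form of
  \<open>M\<close> at the nonzero vector \<open>x\<close>.\<close>

lemma one_inner_inv_pos:
  fixes M :: "real ^ 'n ^ 'n"
  assumes "pos_def_matrix M"
  shows "0 < 1 \<bullet> (matrix_inv M *v 1)"
proof -
  let ?x = "matrix_inv M *v 1"
  have Mx: "M *v ?x = 1"
    by (simp add: invertible_matrix_inv_mult_vector pos_def_matrix_invertible assms)
  then have "?x \<noteq> 0"
    by (metis matrix_vector_mult_0_right zero_neq_one)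
  then show ?thesis
    using assms Mx unfolding pos_def_matrix_def by (metis inner_commute)
qed

lemma pos_def_matrix_arg_min_iff:
  fixes M :: "real ^ 'n ^ 'n"
  assumes M: "pos_def_matrix M"
  shows "is_arg_min (\<lambda>v. v \<bullet> (M *v v)) (\<lambda>v. 1 \<bullet> v = 1) w \<longleftrightarrow> w = budget_weight M"
proof -
  define b where "b = budget_weight M"
  define a where "a = 1 \<bullet> (matrix_inv M *v 1)"
  have "a > 0"
    unfolding a_def using M by (rule one_inner_inv_pos)
  have b: "b = (1 / a) *\<^sub>R (matrix_inv M *v 1)"
    by (simp add: b_def a_def budget_weight_def)
  have feasible: "1 \<bullet> b = 1"
    using \<open>a > 0\<close> by (simp add: b flip: a_def)
  \<comment> \<open>Stationarity: \<open>1 / a\<close> acts as the Lagrange multiplier up to a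
    factor 2.\<close>
  have Mb: "M *v b = (1 / a) *\<^sub>R 1"
    using M by (simp add: b matrix_vector_mult_scaleR invertible_matrix_inv_mult_vector
        pos_def_matrix_invertible)
  have split: "v \<bullet> (M *v v) = b \<bullet> (M *v b) + (v - b) \<bullet> (M *v (v - b))" if "1 \<bullet> v = 1" for v
  proof -
    \<comment> \<open>Two feasible vectors differ by a vector orthogonal to
      \<open>1\<close>.\<close>
    have "(v - b) \<bullet> (M *v b) = 0"
      using that feasible by (simp add: Mb inner_diff_right inner_commute[of _ 1])
    then show ?thesis
      using pos_def_matrix_quadratic_expand[OF M, of v b] by simp
  qed
  have strict: "b \<bullet> (M *v b) < v \<bullet> (M *v v)" if "1 \<bullet> v = 1" "v \<noteq> b" for v
    using split[OF that(1)] M that(2) by (simp add: pos_def_matrix_def)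
  show ?thesis
    unfolding b_def[symmetric] is_arg_min_def using feasible strict by (metis less_asym)
qed

text \<open>As \<open>matrix_inv\<close> and division are total, the first two conjuncts certify
  that the formula for the optimum is meaningful.\<close>

theorem proposition2:
  fixes \<Sigma> C U :: "real ^ 'n ^ 'n" and \<sigma> c :: "real ^ 'n" and t :: real
  assumes "orthogonal_matrix U"
    and "\<Sigma> = U ** diag_matrix (\<chi> i. (\<sigma> $ i)\<^sup>2) ** transpose U"
    and "C = U ** diag_matrix c ** transpose U"
    and "\<And>i. (\<sigma> $ i)\<^sup>2 > 0"
    and "\<And>i. c $ i > 0"
    and "0 \<le> t" and "t \<le> 1"
  shows "invertible (mixed_matrix t \<Sigma> C)
    \<and> 1 \<bullet> (matrix_inv (mixed_matrix t \<Sigma> C) *v 1) \<noteq> 0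
    \<and> (\<forall>w. is_arg_min (\<lambda>v. v \<bullet> (mixed_matrix t \<Sigma> C *v v)) (\<lambda>v. 1 \<bullet> v = 1) w
          \<longleftrightarrow> w = budget_weight (mixed_matrix t \<Sigma> C))"
proof -
  let ?M = "mixed_matrix t \<Sigma> C"
  have "0 < t * (\<sigma> $ i)\<^sup>2 + (1 - t) * c $ i" for i
    using assms(4)[of i] assms(5)[of i] assms(6,7)
    \<comment> \<open>For \<open>t > 0\<close> the first summand is positive and the second
      nonnegative; at \<open>t = 0\<close> only \<open>c $ i\<close> remains.\<close>
    by (cases "t = 0") (auto intro!: add_pos_nonneg)
  then have "pos_def_matrix ?M"
    unfolding assms(2,3) mixed_matrix_diagonal
    by (intro pos_def_matrix_diagonalizable assms(1)) simp
  then show ?thesis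
    by (simp add: pos_def_matrix_invertible pos_def_matrix_arg_min_iff
        one_inner_inv_pos[THEN less_imp_neq, THEN not_sym])
qed

end
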